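(* Let $G$ be a planar triangulation with $n$ vertices, and let $\chi: V(G)\to\{1,2,3,4\}$ be a proper $4$-coloring of $G$ with color classes $V_1,V_2,V_3,V_4$ of sizes $n_1 \ge n_2 \ge n_3 \ge n_4$, respectively. If $n_1 + n_4 \le \frac{2n}{3}$ or $n_1 \le \frac{n}{2}$, then $G$ has a polychromatic $2$-coloring whose discrepancy is at most $\frac{n}{3}$.
   Context: Graphs are finite and simple. A planar triangulation is a simple plane graph (planar graph with a fixed embedding) in which every face, including the outer face, is bounded by a triangle. A polychromatic $2$-coloring of $G$ is an assignment of one of two colors to each vertex (not necessarily a proper coloring) such that no face of $G$ is monochromatic. The discrepancy of a $2$-coloring with color classes $R$ and $B$ is $\big||R|-|B|\big|$. *)

theory Defs
  imports "HOL-Analysis.Analysis"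
begin

locale simple_graph =
  fixes V :: "'a set" and E :: "'a set set"
  assumes finite_vertices: "finite V"
    and edges: "e \<in> E \<Longrightarrow> e \<subseteq> V \<and> card e = 2"

text \<open>
  The embedding is part of the data of a plane graph: \<open>pos\<close> places the vertices and
  \<open>crv\<close> draws each edge as an arc in the Euclidean plane, represented by \<open>complex\<close>.
  The orientation of these arcs is irrelevant.
\<close>
locale plane_graph = simple_graph V E
  for V :: "'a set" and E :: "'a set set" +
  fixes pos :: "'a \<Rightarrow> complex" and crv :: "'a set \<Rightarrow> real \<Rightarrow> complex"
  assumes inj_pos: "inj_on pos V"
    and arc_crv: "e \<in> E \<Longrightarrow> arc (crv e)"
    and ends_crv: "e \<in> E \<Longrightarrow> {pathstart (crv e), pathfinish (crv e)} = pos ` e"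
    and vertex_on_crv: "\<lbrakk>e \<in> E; v \<in> V; pos v \<in> path_image (crv e)\<rbrakk> \<Longrightarrow> v \<in> e"
    and crv_Int: "\<lbrakk>e \<in> E; f \<in> E; e \<noteq> f\<rbrakk>
      \<Longrightarrow> path_image (crv e) \<inter> path_image (crv f) \<subseteq> pos ` (e \<inter> f)"
begin

definition drawing :: "complex set" where
  "drawing = pos ` V \<union> (\<Union>e\<in>E. path_image (crv e))"

text \<open>The unbounded component is the outer face, so it is included.\<close>
definition faces :: "complex set set" where
  "faces = components (- drawing)"

definition face_vertices :: "complex set \<Rightarrow> 'a set" where
  "face_vertices F = {v \<in> V. pos v \<in> frontier F}"

definition bounded_by_triangle :: "complex set \<Rightarrow> bool" where
  "bounded_by_triangle F \<longleftrightarrow>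
    (\<exists>a b c. a \<noteq> b \<and> b \<noteq> c \<and> a \<noteq> c \<and> {a, b} \<in> E \<and> {b, c} \<in> E \<and> {a, c} \<in> E \<and>
      frontier F = path_image (crv {a, b}) \<union> path_image (crv {b, c}) \<union> path_image (crv {a, c}))"

end

locale planar_triangulation = plane_graph +
  assumes triangular_faces: "F \<in> faces \<Longrightarrow> bounded_by_triangle F"

definition color_class :: "'a set \<Rightarrow> ('a \<Rightarrow> nat) \<Rightarrow> nat \<Rightarrow> 'a set" where
  "color_class V c i = {v \<in> V. c v = i}"

definition (in simple_graph) proper_coloring :: "nat \<Rightarrow> ('a \<Rightarrow> nat) \<Rightarrow> bool" where
  "proper_coloring k c \<longleftrightarrow>
    c ` V \<subseteq> {1..k} \<and> (\<forall>u v. {u, v} \<in> E \<longrightarrow> c u \<noteq> c v)"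

definition (in plane_graph) polychromatic_2_coloring :: "('a \<Rightarrow> nat) \<Rightarrow> bool" where
  "polychromatic_2_coloring c \<longleftrightarrow>
    c ` V \<subseteq> {1, 2} \<and>
    (\<forall>F\<in>faces. \<not> (\<exists>i. \<forall>v\<in>face_vertices F. c v = i))"

definition discrepancy :: "'a set \<Rightarrow> ('a \<Rightarrow> nat) \<Rightarrow> int" where
  "discrepancy V c = \<bar>int (card (color_class V c 1)) - int (card (color_class V c 2))\<bar>"

end

theory Submission
  imports Defs
begin

text \<open>
  Pair the largest with the smallest colour class and the two middle ones with each other. Every
  face carries three distinct colours, so no face lies within two classes. From
  \<open>3 n\<^sub>1 + n\<^sub>4 \<ge> n\<close> the first part has at least \<open>n/3\<close> vertices, and it has at most \<open>2n/3\<close>: this is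
  the first alternative, and the second implies it, since \<open>n\<^sub>1 \<le> n/2\<close> and \<open>n\<^sub>1 + n\<^sub>4 > 2n/3\<close> would
  give \<open>n\<^sub>2, n\<^sub>3 \<ge> n\<^sub>4 > n/6\<close> and hence \<open>n\<^sub>1 + n\<^sub>4 < 2n/3\<close>.
\<close>

definition merge_14_23 :: "('a \<Rightarrow> nat) \<Rightarrow> 'a \<Rightarrow> nat" where
  "merge_14_23 col v = (if col v \<in> {1, 4} then 1 else 2)"

context plane_graph
begin

text \<open>Bridges two descriptions of a face: its frontier is given as three arcs, while
  \<open>face_vertices\<close> asks which vertices lie on it.\<close>

lemma pos_in_edge_image:
  assumes "e \<in> E" "v \<in> e"
  shows "pos v \<in> path_image (crv e)"
  using ends_crv[OF assms(1)] assms(2) pathstart_in_path_image pathfinish_in_path_image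
  by (metis imageI insertE singletonD)

lemma polychromatic_merge_14_23:
  assumes tri: "\<And>F. F \<in> faces \<Longrightarrow> bounded_by_triangle F"
    and proper: "proper_coloring 4 col"
  shows "polychromatic_2_coloring (merge_14_23 col)"
proof -
  have "\<not> (\<forall>v\<in>face_vertices F. merge_14_23 col v = i)" if F: "F \<in> faces" for F i
  proof
    assume mono: "\<forall>v\<in>face_vertices F. merge_14_23 col v = i"
    obtain a b c where abc: "{a, b} \<in> E" "{b, c} \<in> E" "{a, c} \<in> E"
      and fr: "frontier F =
        path_image (crv {a, b}) \<union> path_image (crv {b, c}) \<union> path_image (crv {a, c})"
      using tri[OF F] unfolding bounded_by_triangle_def by blast
    have V: "a \<in> V" "b \<in> V" "c \<in> V"
      using edges abc by blast+
    have "pos a \<in> frontier F" "pos b \<in> frontier F" "pos c \<in> frontier F"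
      using pos_in_edge_image abc fr by auto
    with mono V have "merge_14_23 col a = i" "merge_14_23 col b = i" "merge_14_23 col c = i"
      by (auto simp: face_vertices_def)
    moreover have "col ` V \<subseteq> {1..4}"
      using proper unfolding proper_coloring_def by blast
    then have "col a \<in> {1, 2, 3, 4}" "col b \<in> {1, 2, 3, 4}" "col c \<in> {1, 2, 3, 4}"
      using V by force+
    moreover have "col a \<noteq> col b" "col b \<noteq> col c" "col a \<noteq> col c"
      using proper abc unfolding proper_coloring_def by blast+
    \<comment> \<open>Pigeonhole: each merged colour comes from only two of the four colours, too
      few for three distinct ones.\<close>
    ultimately show False
      unfolding merge_14_23_def by (elim insertE emptyE) simp_all
  qed
  then show ?thesis
    unfolding polychromatic_2_coloring_def by (auto simp: merge_14_23_def)
qed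

end

lemma card_color_class_Un:
  assumes "finite V" "i \<noteq> j"
  shows "card (color_class V c i \<union> color_class V c j) =
    card (color_class V c i) + card (color_class V c j)"
  using assms by (intro card_Un_disjoint) (auto simp: color_class_def)

text \<open>The else branch of \<open>merge_14_23\<close> catches every value other than 1 and 4;
  the range hypothesis leaves only 2 and 3 there.\<close>

lemma color_classes_merge_14_23:
  assumes "col ` V \<subseteq> {1..4}"
  shows "color_class V (merge_14_23 col) 1 = color_class V col 1 \<union> color_class V col 4"
    and "color_class V (merge_14_23 col) 2 = color_class V col 2 \<union> color_class V col 3"
proof -
  have "col v = 1 \<or> col v = 2 \<or> col v = 3 \<or> col v = 4" if "v \<in> V" for v
  proof -
    have "1 \<le> col v" "col v \<le> 4"
      using assms that by auto
    then show ?thesis by linarith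
  qed
  then show "color_class V (merge_14_23 col) 1 = color_class V col 1 \<union> color_class V col 4"
    and "color_class V (merge_14_23 col) 2 = color_class V col 2 \<union> color_class V col 3"
    by (force simp: color_class_def merge_14_23_def)+
qed

lemma card_color_classes_2:
  assumes "finite V" "c ` V \<subseteq> {1, 2}"
  shows "card V = card (color_class V c 1) + card (color_class V c 2)"
proof -
  have "V = color_class V c 1 \<union> color_class V c 2"
    using assms(2) by (auto simp: color_class_def)
  then show ?thesis
    using card_color_class_Un[OF assms(1), of 1 2 c] by simp
qed

theorem lemma3:
  fixes V :: "'a set" and E :: "'a set set"
    and pos :: "'a \<Rightarrow> complex" and crv :: "'a set \<Rightarrow> real \<Rightarrow> complex"
    and col :: "'a \<Rightarrow> nat" and n n1 n2 n3 n4 :: nat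
  assumes "planar_triangulation V E pos crv"
    and "n = card V"
    and "simple_graph.proper_coloring V E 4 col"
    and "n1 = card (color_class V col 1)"
    and "n2 = card (color_class V col 2)"
    and "n3 = card (color_class V col 3)"
    and "n4 = card (color_class V col 4)"
    and "n1 \<ge> n2" and "n2 \<ge> n3" and "n3 \<ge> n4"
    and "real (n1 + n4) \<le> 2 * real n / 3 \<or> real n1 \<le> real n / 2"
  shows "\<exists>c. plane_graph.polychromatic_2_coloring V E pos crv c \<and>
             real_of_int (discrepancy V c) \<le> real n / 3"
proof -
  interpret planar_triangulation V E pos crv by fact
  let ?c = "merge_14_23 col"
  have range: "col ` V \<subseteq> {1..4}"
    using assms(3) by (simp add: proper_coloring_def)
  have c1: "card (color_class V ?c 1) = n1 + n4" and c2: "card (color_class V ?c 2) = n2 + n3"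
    using assms(4-7) by (simp_all only: color_classes_merge_14_23[OF range]
        card_color_class_Un[OF finite_vertices])
  have "?c ` V \<subseteq> {1, 2}"
    by (auto simp: merge_14_23_def)
  then have n: "n = n1 + n2 + n3 + n4"
    using card_color_classes_2[OF finite_vertices, of ?c] c1 c2 assms(2) by simp
  \<comment> \<open>Both \<open>n2\<close> and \<open>n3\<close> are at most \<open>n1\<close>, so
    \<open>n\<close> is at most \<open>3 * n1 + n4\<close>.\<close>
  have "n \<le> 3 * (n1 + n4)"
    unfolding n using assms(8-10) by simp
  \<comment> \<open>The claim amounts to \<open>n1 + n4 \<le> 2 * (n2 + n3)\<close>. In the second
    alternative, \<open>n1 \<le> n2 + n3 + n4\<close>; add \<open>n4\<close> to both sides and use
    \<open>2 * n4 \<le> n2 + n3\<close>.\<close>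
  moreover have "3 * (n1 + n4) \<le> 2 * n"
    using assms(11) unfolding n using assms(8-10) by (auto simp: field_simps)
  \<comment> \<open>With \<open>s = n1 + n4\<close> the discrepancy is
    \<open>\<bar>2 * s - n\<bar>\<close>, at most n/3 exactly when s lies between n/3 and
    2n/3.\<close>
  ultimately have "3 * discrepancy V ?c \<le> int n"
    unfolding discrepancy_def c1 c2 n by (auto simp: abs_if)
  then have "real_of_int (discrepancy V ?c) \<le> real n / 3"
    by linarith
  then show ?thesis
    using polychromatic_merge_14_23[OF triangular_faces assms(3)] by blast
qed

end
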